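(* Let $1 \leq p < \infty$, $\alpha > -1$ and $\beta > 0$. For $f \in M^\alpha_\beta$ set $$t_1(f) = \operatorname{dist}_{M^\alpha_\beta}(f, M^\alpha_{p,\beta}) = \inf_{g \in M^\alpha_{p,\beta}} \| f-g\|_{\alpha,\beta},$$ $$t_2(f) = \inf\left\{ \epsilon > 0 : \int_0^1 \chi_{\tilde L^\alpha_{\epsilon,\beta}(f)}(r)\,(1-r)^{-1}\,dr < \infty \right\}.$$ Then $t_1(f) \asymp t_2(f)$, with constants depending only on $\alpha$, $\beta$, $p$ and $n$; that is, there is a constant $C \geq 1$ depending only on $\alpha,\beta,p,n$ such that $C^{-1}t_2(f) \leq t_1(f) \leq C t_2(f)$ for every $f \in M^\alpha_\beta$.
   Context: $\mathbb B$ is the open unit ball in $\mathbb R^n$, and $h(\mathbb B)$ is the space of all harmonic functions on $\mathbb B$. $dw$ denotes Lebesgue measure on $\mathbb B$ normalized so that $\int_{\mathbb B}dw = 1$. For $0\le r<1$, $\alpha>-1$ and $f\in h(\mathbb B)$, $$A_\alpha(f,r) = \int_{|w|\le r}|f(w)|(1-|w|)^\alpha\,dw.$$ For $\alpha>-1$, $\beta>0$ and $0<p<\infty$, $$M^\alpha_\beta = M^\alpha_\beta(\mathbb B)= \Big\{ f\in h(\mathbb B): \|f\|_{\alpha,\beta} = \sup_{0\le r<1}(1-r)^\beta A_\alpha(f,r)<\infty\Big\},$$ $$M^\alpha_{p,\beta} = M^\alpha_{p,\beta}(\mathbb B)= \Big\{ f\in h(\mathbb B): \|f\|^p_{\alpha,\beta;p}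 = \int_0^1(1-r)^{\beta p-1}A_\alpha(f,r)^p\,dr<\infty\Big\}.$$ One has $M^\alpha_{p,\beta}\subset M^\alpha_\beta$. For $\epsilon>0$, $\alpha>-1$, $\beta>0$ and $f\in h(\mathbb B)$, $$\tilde L^\alpha_{\epsilon,\beta}(f) = \{ r\in(0,1) : (1-r)^\beta A_\alpha(f,r)\ge\epsilon\},$$ and $\chi_E$ denotes the characteristic function of a set $E$. *)

theory Defs
  imports "HOL-Analysis.Analysis"
begin

definition dir_deriv :: "'a::euclidean_space \<Rightarrow> ('a \<Rightarrow> 'b::real_normed_vector) \<Rightarrow> 'a \<Rightarrow> 'b" where
  "dir_deriv v f x = frechet_derivative f (at x) v"

definition laplacian :: "('a::euclidean_space \<Rightarrow> 'b::real_normed_vector) \<Rightarrow> 'a \<Rightarrow> 'b" where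
  "laplacian f x = (\<Sum>b\<in>Basis. dir_deriv b (dir_deriv b f) x)"

text \<open>Meant for open \<open>S\<close>: the first three conjuncts say that \<open>f\<close> is twice continuously
  differentiable on \<open>S\<close>.  Values of \<open>f\<close> outside \<open>S\<close> are irrelevant.\<close>

definition harmonic_on :: "'a set \<Rightarrow> ('a::euclidean_space \<Rightarrow> 'b::real_normed_vector) \<Rightarrow> bool" where
  "harmonic_on S f \<longleftrightarrow>
     (\<forall>x\<in>S. f differentiable (at x)) \<and>
     (\<forall>b\<in>Basis. \<forall>x\<in>S. dir_deriv b f differentiable (at x)) \<and>
     (\<forall>b\<in>Basis. \<forall>c\<in>Basis. continuous_on S (dir_deriv c (dir_deriv b f))) \<and>
     (\<forall>x\<in>S. laplacian f x = 0)"

definition A_int :: "real \<Rightarrow> ('a::euclidean_space \<Rightarrow> 'b::real_normed_vector) \<Rightarrow> real \<Rightarrow> real" where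
  "A_int \<alpha> f r =
     (LINT w:cball 0 r|uniform_measure lborel (ball 0 1). norm (f w) * (1 - norm w) powr \<alpha>)"

text \<open>The norms and infima below live in \<^typ>\<open>ennreal\<close>, so that suprema and integrals which are
  not finite are really \<open>\<infinity>\<close>, and no side conditions on \<open>Sup\<close> and \<open>Inf\<close> are needed.\<close>

definition M_norm :: "real \<Rightarrow> real \<Rightarrow> ('a::euclidean_space \<Rightarrow> 'b::real_normed_vector) \<Rightarrow> ennreal" where
  "M_norm \<alpha> \<beta> f = (SUP r\<in>{0..<1}. ennreal ((1 - r) powr \<beta> * A_int \<alpha> f r))"

definition M_space :: "real \<Rightarrow> real \<Rightarrow> ('a::euclidean_space \<Rightarrow> 'b::real_normed_vector) set" where
  "M_space \<alpha> \<beta> = {f. harmonic_on (ball 0 1) f \<and> M_norm \<alpha> \<beta> f < \<infinity>}"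

definition Mp_space :: "real \<Rightarrow> real \<Rightarrow> real \<Rightarrow> ('a::euclidean_space \<Rightarrow> 'b::real_normed_vector) set" where
  "Mp_space \<alpha> p \<beta> = {f. harmonic_on (ball 0 1) f \<and>
     (\<integral>\<^sup>+r\<in>{0<..<1}. ennreal ((1 - r) powr (\<beta> * p - 1) * A_int \<alpha> f r powr p) \<partial>lborel) < \<infinity>}"

definition L_set :: "real \<Rightarrow> real \<Rightarrow> real \<Rightarrow> ('a::euclidean_space \<Rightarrow> 'b::real_normed_vector) \<Rightarrow> real set" where
  "L_set \<alpha> \<epsilon> \<beta> f = {r\<in>{0<..<1}. (1 - r) powr \<beta> * A_int \<alpha> f r \<ge> \<epsilon>}"

definition t1 :: "real \<Rightarrow> real \<Rightarrow> real \<Rightarrow> ('a::euclidean_space \<Rightarrow> 'b::real_normed_vector) \<Rightarrow> ennreal" where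
  "t1 \<alpha> \<beta> p f = (INF g\<in>Mp_space \<alpha> p \<beta>. M_norm \<alpha> \<beta> (\<lambda>w. f w - g w))"

definition t2 :: "real \<Rightarrow> real \<Rightarrow> ('a::euclidean_space \<Rightarrow> 'b::real_normed_vector) \<Rightarrow> ennreal" where
  "t2 \<alpha> \<beta> f = (INF \<epsilon>\<in>{\<epsilon>. 0 < \<epsilon> \<and>
     (\<integral>\<^sup>+r\<in>{0<..<1}. indicator (L_set \<alpha> \<epsilon> \<beta> f) r * ennreal (inverse (1 - r)) \<partial>lborel) < \<infinity>}.
     ennreal \<epsilon>)"

end

theory Submission
  imports Defs
begin

text \<open>Write \<open>\<phi>(r) = (1 - r)\<^sup>\<beta> A\<^sub>\<alpha>(f, r)\<close>. As \<open>A\<^sub>\<alpha>(f, \<cdot>)\<close> is increasing, \<open>t\<^sub>2(f)\<close> is comparable to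
  the upper limit of \<open>\<phi>\<close> at \<open>1\<close>: a point with \<open>\<phi> > 2\<^sup>\<beta> \<epsilon>\<close> forces \<open>\<phi> \<ge> \<epsilon>\<close> on an interval of
  logarithmic length bounded below, so such points cannot accumulate at \<open>1\<close>. A competitor in
  \<open>M\<^sup>\<alpha>\<^sub>p\<^sub>,\<^sub>\<beta>\<close> is then a dilate \<open>f\<^sub>\<rho>(w) = f(\<rho> w)\<close>: on a fixed ball \<open>f - f\<^sub>\<rho>\<close> is uniformly small, and near
  the boundary both \<open>f\<close> and \<open>f\<^sub>\<rho>\<close> contribute a multiple of \<open>\<epsilon>\<close>. For \<open>\<alpha> < 0\<close> not every \<open>\<rho>\<close> is
  suitable without the subharmonicity of \<open>|f|\<close>; averaging over \<open>\<rho> \<in> [1 - \<delta>, 1 - \<delta>/2]\<close> with Tonelli's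
  theorem, where \<open>\<alpha> > -1\<close> makes the dilated weight integrable in \<open>\<rho>\<close>, produces one that is.
  Harmonicity is used only to know that \<open>f\<^sub>\<rho>\<close> is again harmonic.\<close>

section \<open>Scaling of Lebesgue integrals and one-dimensional weight integrals\<close>

lemma nn_integral_lborel_scaleR:
  fixes h :: "'a::euclidean_space \<Rightarrow> ennreal"
  assumes [measurable]: "h \<in> borel_measurable borel" and c: "c > 0"
  shows "(\<integral>\<^sup>+x. h (c *\<^sub>R x) \<partial>lborel) = ennreal (1 / c ^ DIM('a)) * (\<integral>\<^sup>+x. h x \<partial>lborel)"
proof -
  have "(\<integral>\<^sup>+x. h x \<partial>lborel) = ennreal (c ^ DIM('a)) * (\<integral>\<^sup>+x. h (c *\<^sub>R x) \<partial>lborel)"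
    using c by (subst lborel_affine[of c 0])
      (simp_all add: nn_integral_density nn_integral_distr nn_integral_cmult)
  then show ?thesis
    using c by (simp add: mult.assoc[symmetric] ennreal_mult[symmetric])
qed

lemma nn_integral_powr_shift:
  fixes a s L :: real
  assumes "a > -1" "L \<ge> 0"
  shows "(\<integral>\<^sup>+x\<in>{s..s+L}. ennreal ((x - s) powr a) \<partial>lborel) = ennreal (L powr (a+1) / (a+1))"
proof -
  have "(\<integral>\<^sup>+x\<in>{0..L}. ennreal (x powr a) \<partial>lborel) = ennreal (L powr (a+1) / (a+1))"
    by (intro nn_integral_has_integral_lebesgue' has_integral_powr_from_0 assms) auto
  also have "(\<integral>\<^sup>+x\<in>{0..L}. ennreal (x powr a) \<partial>lborel)
      = (\<integral>\<^sup>+x. ennreal ((x - s) powr a) * indicator {0..L} (x - s) \<partial>lborel)"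
    by (subst nn_integral_real_affine[where c=1 and t="-s"]) auto
  also have "(\<lambda>x. indicator {0..L} (x - s) :: ennreal) = indicator {s..s+L}"
    by (auto simp: indicator_def fun_eq_iff)
  finally show ?thesis
    by metis
qed

lemma nn_integral_const_Icc:
  fixes a b k :: real
  assumes "a \<le> b" "k \<ge> 0"
  shows "(\<integral>\<^sup>+x\<in>{a..b}. ennreal k \<partial>lborel) = ennreal (k * (b - a))"
  using assms by (subst nn_integral_cmult_indicator) (simp_all add: ennreal_mult')

lemma nn_integral_one_minus_powr_finite:
  fixes c :: real
  assumes "c > 0"
  shows "(\<integral>\<^sup>+r\<in>{0<..<1}. ennreal ((1 - r) powr (c - 1)) \<partial>lborel) < \<infinity>"
proof -
  have "(\<integral>\<^sup>+r\<in>{0<..<1}. ennreal ((1 - r) powr (c - 1)) \<partial>lborel)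
      = (\<integral>\<^sup>+x. ennreal (x powr (c - 1)) * indicator {0<..<1} (1 - x) \<partial>lborel)"
    by (subst nn_integral_real_affine[where c="-1" and t=1]) auto
  also have "\<dots> \<le> (\<integral>\<^sup>+x\<in>{0..0+1}. ennreal ((x - 0) powr (c - 1)) \<partial>lborel)"
    by (intro nn_integral_mono) (auto simp: indicator_def)
  also have "\<dots> < \<infinity>"
    using assms by (subst nn_integral_powr_shift) auto
  finally show ?thesis .
qed

text \<open>For \<alpha> \<ge> 0 the dilated weight is at most \<open>(1 - s) powr \<alpha>\<close>
  pointwise. For \<alpha> < 0 it is at most \<open>(\<rho> - s) powr \<alpha>\<close>, whose
  singularity at \<open>\<rho> = s\<close> is integrable because \<open>\<alpha> > -1\<close>.
  Averaging over \<rho> thus tames a weight that single values of \<rho> do not control.\<close>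

lemma nn_integral_dilated_weight_le:
  fixes \<alpha> :: real
  assumes "\<alpha> > -1"
  shows "\<exists>C>0. \<forall>\<delta> s. 0 < \<delta> \<longrightarrow> \<delta> \<le> 1/2 \<longrightarrow> 0 \<le> s \<longrightarrow> s \<le> 1 - \<delta>/2 \<longrightarrow>
      (\<integral>\<^sup>+\<rho>\<in>{1-\<delta>..1-\<delta>/2}. (if s < \<rho> then ennreal ((1 - s / \<rho>) powr \<alpha>) else 0) \<partial>lborel)
        \<le> ennreal (C * \<delta> * (1 - s) powr \<alpha>)"
proof -
  \<comment> \<open>The first summand serves the singular integral near \<open>\<rho> = s\<close>,
    the second the values of \<open>s\<close> far from 1; being at least 1, the second also covers
    \<alpha> \<ge> 0.\<close>
  define C where "C = 2 / (\<alpha> + 1) + 2 powr \<bar>\<alpha>\<bar>"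
  have Cpos: "C > 0" "C \<ge> 2 / (\<alpha>+1)" "C \<ge> 2 powr \<bar>\<alpha>\<bar>"
    using assms unfolding C_def by (auto intro!: add_pos_nonneg)
  have C1: "C \<ge> 1"
    using Cpos(3) ge_one_powr_ge_zero[of 2 "\<bar>\<alpha>\<bar>"] by simp
  have bounded_case: "(\<integral>\<^sup>+\<rho>\<in>{1-\<delta>..1-\<delta>/2}. (if s < \<rho> then ennreal ((1 - s / \<rho>) powr \<alpha>) else 0) \<partial>lborel)
        \<le> ennreal (C * \<delta> * (1 - s) powr \<alpha>)"
    if "0 < \<delta>" and le: "\<And>\<rho>. \<lbrakk>1 - \<delta> \<le> \<rho>; \<rho> \<le> 1 - \<delta>/2; s < \<rho>\<rbrakk> \<Longrightarrow> (1 - s / \<rho>) powr \<alpha> \<le> C * (1 - s) powr \<alpha>"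
    for \<delta> s
  proof -
    have "(\<integral>\<^sup>+\<rho>\<in>{1-\<delta>..1-\<delta>/2}. (if s < \<rho> then ennreal ((1 - s / \<rho>) powr \<alpha>) else 0) \<partial>lborel)
      \<le> (\<integral>\<^sup>+\<rho>\<in>{1-\<delta>..1-\<delta>/2}. ennreal (C * (1 - s) powr \<alpha>) \<partial>lborel)"
      using le by (intro nn_integral_mono) (auto simp: indicator_def intro!: ennreal_leI)
    also have "\<dots> = ennreal (C * (1 - s) powr \<alpha> * (\<delta>/2))"
      using that Cpos by (subst nn_integral_const_Icc) auto
    also have "\<dots> \<le> ennreal (C * \<delta> * (1 - s) powr \<alpha>)"
      using that Cpos by (intro ennreal_leI) (simp add: field_simps)
    finally show ?thesis .
  qed
  have "(\<integral>\<^sup>+\<rho>\<in>{1-\<delta>..1-\<delta>/2}. (if s < \<rho> then ennreal ((1 - s / \<rho>) powr \<alpha>) else 0) \<partial>lborel)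
        \<le> ennreal (C * \<delta> * (1 - s) powr \<alpha>)"
    if \<delta>: "0 < \<delta>" "\<delta> \<le> 1/2" and s: "0 \<le> s" "s \<le> 1 - \<delta>/2" for \<delta> s
  proof (cases "\<alpha> \<ge> 0")
    case True
    show ?thesis
    proof (rule bounded_case)
      fix \<rho> assume \<rho>: "1 - \<delta> \<le> \<rho>" "\<rho> \<le> 1 - \<delta>/2" "s < \<rho>"
      then have "s \<le> s / \<rho>" "s / \<rho> \<le> 1"
        using \<delta> s by (auto simp: field_simps mult_left_le_one_le)
      then have "(1 - s / \<rho>) powr \<alpha> \<le> 1 * (1 - s) powr \<alpha>"
        using True by (auto intro!: powr_mono2)
      also have "\<dots> \<le> C * (1 - s) powr \<alpha>"
        using C1 by (intro mult_right_mono) auto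
      finally show "(1 - s / \<rho>) powr \<alpha> \<le> C * (1 - s) powr \<alpha>" .
    qed fact
  next
    case False
    have le: "(1 - s / \<rho>) powr \<alpha> \<le> (\<rho> - s) powr \<alpha>"
      if \<rho>: "1 - \<delta> \<le> \<rho>" "\<rho> \<le> 1 - \<delta>/2" "s < \<rho>" for \<rho>
    proof (rule powr_mono2')
      have "(\<rho> - s) * \<rho> \<le> (\<rho> - s) * 1"
        using \<delta> \<rho> by (intro mult_left_mono) auto
      then show "\<rho> - s \<le> 1 - s / \<rho>"
        using \<delta> \<rho> by (simp add: field_simps)
    qed (use False \<rho> in auto)
    show ?thesis
    \<comment> \<open>Below the threshold, \<open>\<rho> \<ge> 1 - \<delta>\<close> gives
      \<open>\<rho> - s \<ge> (1 - s) / 2\<close>, so a pointwise bound suffices. Above it,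
      \<open>1 - s \<le> 2 * \<delta>\<close>, so \<open>(2 * \<delta>) powr \<alpha>\<close> is at
      most \<open>(1 - s) powr \<alpha>\<close> for negative \<alpha>.\<close>
    proof (cases "s < 1 - 2 * \<delta>")
      case True
      show ?thesis
      proof (rule bounded_case)
        fix \<rho> assume \<rho>: "1 - \<delta> \<le> \<rho>" "\<rho> \<le> 1 - \<delta>/2" "s < \<rho>"
        have "(\<rho> - s) powr \<alpha> \<le> ((1 - s) / 2) powr \<alpha>"
          using True False \<delta> \<rho> by (intro powr_mono2') auto
        also have "\<dots> = 2 powr \<bar>\<alpha>\<bar> * (1 - s) powr \<alpha>"
          using True False \<delta> by (simp add: powr_divide powr_minus field_simps)
        also have "\<dots> \<le> C * (1 - s) powr \<alpha>"
          using Cpos by (intro mult_right_mono) auto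
        finally show "(1 - s / \<rho>) powr \<alpha> \<le> C * (1 - s) powr \<alpha>"
          using le[OF \<rho>] by linarith
      qed fact
    next
      case False': False
      \<comment> \<open>Here \<open>s + 2 * \<delta> \<ge> 1\<close>, so the interval starting at
        the singularity contains every \<rho> that contributes.\<close>
      have "(\<integral>\<^sup>+\<rho>\<in>{1-\<delta>..1-\<delta>/2}. (if s < \<rho> then ennreal ((1 - s / \<rho>) powr \<alpha>) else 0) \<partial>lborel)
        \<le> (\<integral>\<^sup>+\<rho>\<in>{s..s+2*\<delta>}. ennreal ((\<rho> - s) powr \<alpha>) \<partial>lborel)"
        using False' le \<delta> by (intro nn_integral_mono) (auto simp: indicator_def intro!: ennreal_leI)
      also have "\<dots> = ennreal ((2*\<delta>) powr (\<alpha>+1) / (\<alpha>+1))"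
        using assms \<delta> by (intro nn_integral_powr_shift) auto
      also have "\<dots> \<le> ennreal (C * \<delta> * (1 - s) powr \<alpha>)"
      proof (intro ennreal_leI)
        have "(2*\<delta>) powr (\<alpha>+1) / (\<alpha>+1) = 2 / (\<alpha>+1) * \<delta> * (2*\<delta>) powr \<alpha>"
          using \<delta> by (simp add: powr_add)
        also have "\<dots> \<le> C * \<delta> * (1 - s) powr \<alpha>"
          using False False' \<delta> s Cpos assms by (intro mult_mono powr_mono2') auto
        finally show "(2*\<delta>) powr (\<alpha>+1) / (\<alpha>+1) \<le> C * \<delta> * (1 - s) powr \<alpha>" .
      qed
      finally show ?thesis .
    qed
  qed
  with Cpos(1) show ?thesis
    by blast
qed

text \<open>Otherwise the integral would be at least \<open>(b - a) * (Y + e)\<close>, which is too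
  large. The slack \<open>e\<close> spares an argument about strict inequality of integrals.\<close>

lemma nn_integral_Icc_exists_le:
  fixes G :: "real \<Rightarrow> ennreal"
  assumes "a < b" and "Y \<ge> 0" "e > 0"
    and le: "(\<integral>\<^sup>+x\<in>{a..b}. G x \<partial>lborel) \<le> ennreal ((b - a) * Y)"
  obtains x where "x \<in> {a..b}" "G x \<le> ennreal (Y + e)"
proof (rule ccontr)
  assume "\<not> thesis"
  then have *: "\<And>x. x \<in> {a..b} \<Longrightarrow> ennreal (Y + e) \<le> G x"
    using that by (meson linear)
  have "ennreal ((b - a) * (Y + e)) = (\<integral>\<^sup>+x\<in>{a..b}. ennreal (Y + e) \<partial>lborel)"
    using assms by (subst nn_integral_const_Icc) (auto simp: mult.commute)
  also have "\<dots> \<le> (\<integral>\<^sup>+x\<in>{a..b}. G x \<partial>lborel)"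
    using * by (intro nn_integral_mono) (auto simp: indicator_def)
  also note le
  finally have "(b - a) * (Y + e) \<le> (b - a) * Y"
    using assms by (subst (asm) ennreal_le_iff) auto
  then show False
    using assms by (simp add: mult_le_cancel_left)
qed

section \<open>Dilates of harmonic functions\<close>

lemma has_derivative_dilate:
  assumes "f differentiable (at (c *\<^sub>R x))"
  shows "((\<lambda>w. f (c *\<^sub>R w)) has_derivative (\<lambda>v. frechet_derivative f (at (c *\<^sub>R x)) (c *\<^sub>R v))) (at x)"
proof -
  have "(f has_derivative frechet_derivative f (at (c *\<^sub>R x))) (at (c *\<^sub>R x))"
    using assms frechet_derivative_works by blast
  then show ?thesis
    by (rule has_derivative_compose[where f="\<lambda>w. c *\<^sub>R w" and f'="\<lambda>v. c *\<^sub>R v", rotated])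
      (auto intro!: derivative_eq_intros)
qed

lemma dir_deriv_dilate:
  assumes "f differentiable (at (c *\<^sub>R x))"
  shows "dir_deriv v (\<lambda>w. f (c *\<^sub>R w)) x = c *\<^sub>R dir_deriv v f (c *\<^sub>R x)"
  unfolding dir_deriv_def
  by (subst frechet_derivative_at[OF has_derivative_dilate[OF assms], symmetric])
    (simp add: linear_scale[OF linear_frechet_derivative[OF assms]])

text \<open>By the chain rule each derivative brings out one factor \<open>c\<close>, so the
  Laplacian of the dilate at \<open>x\<close> is \<open>c\<^sup>2\<close> times that of
  \<open>f\<close> at \<open>c *\<^sub>R x\<close>.\<close>

lemma harmonic_on_dilate:
  fixes f :: "'a::euclidean_space \<Rightarrow> 'b::real_normed_vector"
  assumes f: "harmonic_on S f" and "open T" and T: "\<And>x. x \<in> T \<Longrightarrow> c *\<^sub>R x \<in> S"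
  shows "harmonic_on T (\<lambda>w. f (c *\<^sub>R w))"
proof -
  have d1: "f differentiable (at (c *\<^sub>R x))" if "x \<in> T" for x
    using f T[OF that] by (auto simp: harmonic_on_def)
  have d2: "dir_deriv b f differentiable (at (c *\<^sub>R x))" if "x \<in> T" "b \<in> Basis" for x b
    using f T[OF that(1)] that(2) by (auto simp: harmonic_on_def)
  \<comment> \<open>The first-order formula is known only on \<open>T\<close>; since
    \<open>T\<close> is open, both sides agree near \<open>x\<close> and may be differentiated
    again.\<close>
  have D: "(dir_deriv b (\<lambda>w. f (c *\<^sub>R w)) has_derivative
      (\<lambda>v. c *\<^sub>R frechet_derivative (dir_deriv b f) (at (c *\<^sub>R x)) (c *\<^sub>R v))) (at x)"
    if x: "x \<in> T" and b: "b \<in> Basis" for x b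
    by (rule has_derivative_transform_within_open
        [OF has_derivative_scaleR_right[OF has_derivative_dilate[OF d2[OF that]]] \<open>open T\<close> x])
      (simp add: dir_deriv_dilate d1)
  have DD: "dir_deriv v (dir_deriv b (\<lambda>w. f (c *\<^sub>R w))) x
      = c\<^sup>2 *\<^sub>R dir_deriv v (dir_deriv b f) (c *\<^sub>R x)"
    if x: "x \<in> T" and b: "b \<in> Basis" for x b v
    unfolding dir_deriv_def[of v]
    by (subst frechet_derivative_at[OF D[OF that], symmetric])
      (simp add: linear_scale[OF linear_frechet_derivative[OF d2[OF that]]] power2_eq_square)
  have "continuous_on T (dir_deriv v (dir_deriv b (\<lambda>w. f (c *\<^sub>R w))))"
    if "v \<in> Basis" "b \<in> Basis" for v b
  proof -
    have "continuous_on S (dir_deriv v (dir_deriv b f))"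
      using f that by (auto simp: harmonic_on_def)
    then have "continuous_on T (\<lambda>x. c\<^sup>2 *\<^sub>R dir_deriv v (dir_deriv b f) (c *\<^sub>R x))"
      using T by (auto intro!: continuous_intros continuous_on_compose2[of S "dir_deriv v (dir_deriv b f)"])
    then show ?thesis
      by (rule continuous_on_eq) (simp add: DD that)
  qed
  moreover have "laplacian (\<lambda>w. f (c *\<^sub>R w)) x = 0" if "x \<in> T" for x
  proof -
    have "laplacian f (c *\<^sub>R x) = 0"
      using f T[OF that] by (auto simp: harmonic_on_def)
    then show ?thesis
      using that by (simp add: laplacian_def DD scaleR_sum_right[symmetric])
  qed
  moreover have "(\<lambda>w. f (c *\<^sub>R w)) differentiable (at x)" if "x \<in> T" for x
    using has_derivative_dilate[OF d1[OF that]] by (auto simp: differentiable_def)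
  moreover have "dir_deriv b (\<lambda>w. f (c *\<^sub>R w)) differentiable (at x)" if "x \<in> T" "b \<in> Basis" for x b
    using D[OF that] unfolding differentiable_def by blast
  ultimately show ?thesis
    by (auto simp: harmonic_on_def)
qed

lemma harmonic_on_imp_continuous_on: "harmonic_on S f \<Longrightarrow> continuous_on S f"
  by (auto simp: harmonic_on_def intro!: continuous_at_imp_continuous_on differentiable_imp_continuous_within)

section \<open>Weighted integrals of dilates\<close>

text \<open>An unnormalized counterpart of \<open>A_int\<close> with values in the extended
  nonnegative reals: Tonelli's theorem applies directly, and the integral over the whole open ball
  makes sense before it is known to be finite.\<close>

definition wint :: "real \<Rightarrow> ('a::euclidean_space \<Rightarrow> 'b::real_normed_vector) \<Rightarrow> 'a set \<Rightarrow> ennreal" where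
  "wint \<alpha> f S = (\<integral>\<^sup>+w\<in>S. ennreal (norm (f w) * (1 - norm w) powr \<alpha>) \<partial>lborel)"

lemma wint_mono: "S \<subseteq> T \<Longrightarrow> wint \<alpha> f S \<le> wint \<alpha> f T"
  unfolding wint_def by (intro nn_integral_mono) (auto simp: indicator_def)

text \<open>For \<open>norm w \<le> r\<close> one has
  \<open>1 - \<rho> \<le> \<delta> \<le> 1 - norm w\<close>, hence
  \<open>1 - \<rho> * norm w \<le> 2 * (1 - norm w)\<close>. The weights at \<open>w\<close> and at
  \<open>\<rho> *\<^sub>R w\<close> therefore compare up to
  \<open>2 powr \<bar>\<alpha>\<bar>\<close>, and substituting \<open>u = \<rho> *\<^sub>R w\<close>
  costs at most \<open>2 ^ DIM('a)\<close>.\<close>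

lemma wint_dilate_le:
  fixes f :: "'a::euclidean_space \<Rightarrow> 'b::real_normed_vector"
  assumes f: "continuous_on (ball 0 1) f"
    and \<rho>: "1/2 \<le> \<rho>" "\<rho> < 1" "1 - \<delta> \<le> \<rho>" and r: "0 \<le> r" "r \<le> 1 - \<delta>" "r < 1"
  shows "wint \<alpha> (\<lambda>w. f (\<rho> *\<^sub>R w)) (cball 0 r) \<le> ennreal (2 ^ DIM('a) * 2 powr \<bar>\<alpha>\<bar>) * wint \<alpha> f (cball 0 r)"
proof -
  \<comment> \<open>Nothing is known about \<open>f\<close> outside the unit ball, so the cutoff is
    what makes the integrand Borel measurable on the whole space.\<close>
  define H where "H u = indicator (cball 0 r) u * (norm (f u) * (1 - norm u) powr \<alpha>)" for u
  have "(\<lambda>u. indicator (cball 0 r) u *\<^sub>R (norm (f u) * (1 - norm u) powr \<alpha>)) \<in> borel_measurable borel"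
    using r by (intro borel_measurable_continuous_on_indicator)
      (auto intro!: continuous_intros continuous_on_subset[OF f])
  then have H[measurable]: "H \<in> borel_measurable borel"
    by (simp add: H_def[abs_def])
  have "wint \<alpha> (\<lambda>w. f (\<rho> *\<^sub>R w)) (cball 0 r)
      \<le> (\<integral>\<^sup>+w. ennreal (2 powr \<bar>\<alpha>\<bar>) * ennreal (H (\<rho> *\<^sub>R w)) \<partial>lborel)"
    unfolding wint_def
  proof (intro nn_integral_mono)
    fix w :: 'a
    have "norm (f (\<rho> *\<^sub>R w)) * (1 - norm w) powr \<alpha> \<le> 2 powr \<bar>\<alpha>\<bar> * H (\<rho> *\<^sub>R w)" if w: "norm w \<le> r"
    proof -
      have "\<rho> * norm w \<le> r"
        using w \<rho> r mult_left_le_one_le[of "norm w" \<rho>] by auto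
      then have H: "H (\<rho> *\<^sub>R w) = norm (f (\<rho> *\<^sub>R w)) * (1 - \<rho> * norm w) powr \<alpha>"
        using \<rho> by (simp add: H_def)
      have "(1 - norm w) powr \<alpha> \<le> 2 powr \<bar>\<alpha>\<bar> * (1 - \<rho> * norm w) powr \<alpha>"
      proof (cases "\<alpha> \<ge> 0")
        case True
        have "(1 - norm w) powr \<alpha> \<le> 1 * (1 - \<rho> * norm w) powr \<alpha>"
          using True w \<rho> r by (auto intro!: powr_mono2 mult_left_le_one_le)
        also have "\<dots> \<le> 2 powr \<bar>\<alpha>\<bar> * (1 - \<rho> * norm w) powr \<alpha>"
          by (intro mult_right_mono) (auto intro!: ge_one_powr_ge_zero)
        finally show ?thesis .
      next
        case False
        have "(1 - \<rho>) * norm w \<le> (1 - \<rho>) * 1"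
          using w \<rho> r by (intro mult_left_mono) auto
        then have "(1 - \<rho> * norm w) / 2 \<le> 1 - norm w"
          using w \<rho> r by (simp add: field_simps)
        then have "(1 - norm w) powr \<alpha> \<le> ((1 - \<rho> * norm w) / 2) powr \<alpha>"
          using False \<open>\<rho> * norm w \<le> r\<close> r by (intro powr_mono2') auto
        also have "\<dots> = 2 powr \<bar>\<alpha>\<bar> * (1 - \<rho> * norm w) powr \<alpha>"
          using False \<open>\<rho> * norm w \<le> r\<close> r by (simp add: powr_divide powr_minus field_simps)
        finally show ?thesis .
      qed
      then show ?thesis
        unfolding H by (simp add: mult_left_mono mult.left_commute)
    qed
    then show "ennreal (norm (f (\<rho> *\<^sub>R w)) * (1 - norm w) powr \<alpha>) * indicator (cball 0 r) w
        \<le> ennreal (2 powr \<bar>\<alpha>\<bar>) * ennreal (H (\<rho> *\<^sub>R w))"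
      by (auto simp: indicator_def ennreal_mult'[symmetric] intro!: ennreal_leI)
  qed
  also have "\<dots> = ennreal (2 powr \<bar>\<alpha>\<bar>) * (ennreal (1 / \<rho> ^ DIM('a)) * (\<integral>\<^sup>+u. ennreal (H u) \<partial>lborel))"
    using \<rho> by (subst nn_integral_cmult, measurable)
      (subst nn_integral_lborel_scaleR[of "\<lambda>u. ennreal (H u)"], auto)
  also have "(\<integral>\<^sup>+u. ennreal (H u) \<partial>lborel) = wint \<alpha> f (cball 0 r)"
    unfolding wint_def H_def by (intro nn_integral_cong) (auto simp: indicator_def)
  also have "ennreal (2 powr \<bar>\<alpha>\<bar>) * (ennreal (1 / \<rho> ^ DIM('a)) * wint \<alpha> f (cball 0 r))
      \<le> ennreal (2 powr \<bar>\<alpha>\<bar>) * (ennreal (2 ^ DIM('a)) * wint \<alpha> f (cball 0 r))"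
  proof (intro mult_left_mono mult_right_mono ennreal_leI)
    have "(1 / \<rho>) ^ DIM('a) \<le> 2 ^ DIM('a)"
      using \<rho> by (intro power_mono) (auto simp: field_simps)
    then show "1 / \<rho> ^ DIM('a) \<le> 2 ^ DIM('a)"
      by (simp add: power_divide)
  qed auto
  finally show ?thesis
    by (simp add: ennreal_mult mult_ac)
qed

text \<open>Substituting \<open>u = \<rho> *\<^sub>R w\<close> turns the unit ball into
  \<open>norm u < \<rho>\<close> and the weight into
  \<open>(1 - norm u / \<rho>) powr \<alpha>\<close>. After exchanging the integrals, the inner one
  over \<rho> is the assumption on \<open>C\<close> at \<open>s = norm u\<close>. As
  \<open>\<rho> \<le> 1 - \<delta>/2\<close>, only a compact ball inside the domain of
  \<open>f\<close> is seen.\<close>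

lemma wint_dilate_average_le:
  fixes f :: "'a::euclidean_space \<Rightarrow> 'b::real_normed_vector"
  assumes f: "continuous_on (ball 0 1) f" and \<delta>: "0 < \<delta>" "\<delta> \<le> 1/2" and "C \<ge> 0"
    and C: "\<And>s. \<lbrakk>0 \<le> s; s \<le> 1 - \<delta>/2\<rbrakk> \<Longrightarrow>
      (\<integral>\<^sup>+\<rho>\<in>{1-\<delta>..1-\<delta>/2}. (if s < \<rho> then ennreal ((1 - s / \<rho>) powr \<alpha>) else 0) \<partial>lborel)
        \<le> ennreal (C * \<delta> * (1 - s) powr \<alpha>)"
  shows "(\<integral>\<^sup>+\<rho>\<in>{1-\<delta>..1-\<delta>/2}. wint \<alpha> (\<lambda>w. f (\<rho> *\<^sub>R w)) (ball 0 1) \<partial>lborel)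
      \<le> ennreal (2 ^ DIM('a) * C * \<delta>) * wint \<alpha> f (cball 0 (1 - \<delta>/2))"
proof -
  define b where "b = 1 - \<delta>/2"
  define F where "F u = indicator (cball 0 b) u * norm (f u)" for u
  have "(\<lambda>u. indicator (cball 0 b) u *\<^sub>R norm (f u)) \<in> borel_measurable borel"
    using \<delta> by (intro borel_measurable_continuous_on_indicator)
      (auto intro!: continuous_intros continuous_on_subset[OF f] simp: b_def)
  then have [measurable]: "F \<in> borel_measurable borel"
    by (simp add: F_def[abs_def])
  have F0: "F u \<ge> 0" for u
    by (simp add: F_def)
  \<comment> \<open>The value 0 for \<open>s \<ge> \<rho>\<close> encodes the domain
    \<open>norm u < \<rho>\<close> inside the kernel, so that it is jointly measurable on the full
    product space.\<close>
  define k where "k s \<rho> = (if s < \<rho> then ennreal ((1 - s / \<rho>) powr \<alpha>) else 0)" for s \<rho> :: real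
  have [measurable]: "(\<lambda>(s, \<rho>). k s \<rho>) \<in> borel_measurable (borel \<Otimes>\<^sub>M borel)"
    unfolding k_def by measurable
  define K where "K u \<rho> = ennreal (F u) * k (norm u) \<rho>" for u \<rho>
  have [measurable]: "(\<lambda>(u, \<rho>). K u \<rho>) \<in> borel_measurable (borel \<Otimes>\<^sub>M borel)"
    unfolding K_def by measurable
  have G: "wint \<alpha> (\<lambda>w. f (\<rho> *\<^sub>R w)) (ball 0 1) \<le> ennreal (2 ^ DIM('a)) * (\<integral>\<^sup>+u. K u \<rho> \<partial>lborel)"
    if \<rho>: "1 - \<delta> \<le> \<rho>" "\<rho> \<le> b" for \<rho>
  proof -
    have \<rho>0: "\<rho> \<ge> 1/2" "\<rho> > 0" "\<rho> < 1"
      using \<rho> \<delta> by (auto simp: b_def)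
    have "wint \<alpha> (\<lambda>w. f (\<rho> *\<^sub>R w)) (ball 0 1) \<le> (\<integral>\<^sup>+w. K (\<rho> *\<^sub>R w) \<rho> \<partial>lborel)"
      unfolding wint_def
    proof (intro nn_integral_mono)
      fix w :: 'a
      show "ennreal (norm (f (\<rho> *\<^sub>R w)) * (1 - norm w) powr \<alpha>) * indicator (ball 0 1) w \<le> K (\<rho> *\<^sub>R w) \<rho>"
      proof (cases "norm w < 1")
        case True
        then have "\<rho> * norm w < \<rho> * 1"
          using \<rho>0 by (intro mult_strict_left_mono) auto
        then have "\<rho> * norm w \<le> b"
          using \<rho> by linarith
        then have "\<rho> *\<^sub>R w \<in> cball 0 b" "norm (\<rho> *\<^sub>R w) < \<rho>"
          using True \<rho> \<rho>0 by auto
        then have "F (\<rho> *\<^sub>R w) = norm (f (\<rho> *\<^sub>R w))" "k (norm (\<rho> *\<^sub>R w)) \<rho> = ennreal ((1 - norm w) powr \<alpha>)"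
          using \<rho> \<rho>0 by (simp_all add: F_def k_def)
        then show ?thesis
          using True by (simp add: K_def ennreal_mult)
      qed auto
    qed
    also have "\<dots> = ennreal (1 / \<rho> ^ DIM('a)) * (\<integral>\<^sup>+u. K u \<rho> \<partial>lborel)"
      using \<rho>0 by (subst nn_integral_lborel_scaleR[of "\<lambda>u. K u \<rho>"]) auto
    also have "\<dots> \<le> ennreal (2 ^ DIM('a)) * (\<integral>\<^sup>+u. K u \<rho> \<partial>lborel)"
    proof (intro mult_right_mono ennreal_leI)
      have "(1 / \<rho>) ^ DIM('a) \<le> 2 ^ DIM('a)"
        using \<rho>0 by (intro power_mono) (auto simp: field_simps)
      then show "1 / \<rho> ^ DIM('a) \<le> 2 ^ DIM('a)"
        by (simp add: power_divide)
    qed auto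
    finally show ?thesis .
  qed
  have "(\<integral>\<^sup>+\<rho>\<in>{1-\<delta>..b}. wint \<alpha> (\<lambda>w. f (\<rho> *\<^sub>R w)) (ball 0 1) \<partial>lborel)
      \<le> (\<integral>\<^sup>+\<rho>. (\<integral>\<^sup>+u. ennreal (2 ^ DIM('a)) * (K u \<rho> * indicator {1-\<delta>..b} \<rho>) \<partial>lborel) \<partial>lborel)"
  proof (intro nn_integral_mono)
    fix \<rho> :: real
    have "(\<integral>\<^sup>+u. ennreal (2 ^ DIM('a)) * (K u \<rho> * indicator {1-\<delta>..b} \<rho>) \<partial>lborel)
      = ennreal (2 ^ DIM('a)) * (\<integral>\<^sup>+u. K u \<rho> \<partial>lborel) * indicator {1-\<delta>..b} \<rho>"
      by (simp add: nn_integral_cmult nn_integral_multc mult.assoc)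
    then show "wint \<alpha> (\<lambda>w. f (\<rho> *\<^sub>R w)) (ball 0 1) * indicator {1-\<delta>..b} \<rho>
        \<le> (\<integral>\<^sup>+u. ennreal (2 ^ DIM('a)) * (K u \<rho> * indicator {1-\<delta>..b} \<rho>) \<partial>lborel)"
      using G[of \<rho>] by (auto simp: indicator_def)
  qed
  \<comment> \<open>Tonelli's theorem: from here the average over \<rho> is taken first, at fixed
    \<open>u\<close>.\<close>
  also have "\<dots> = (\<integral>\<^sup>+u. (\<integral>\<^sup>+\<rho>. ennreal (2 ^ DIM('a)) * (K u \<rho> * indicator {1-\<delta>..b} \<rho>) \<partial>lborel) \<partial>lborel)"
    by (rule lborel_pair.Fubini') measurable
  also have "\<dots> \<le> (\<integral>\<^sup>+u. ennreal (2 ^ DIM('a) * C * \<delta>) *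
      (ennreal (norm (f u) * (1 - norm u) powr \<alpha>) * indicator (cball 0 b) u) \<partial>lborel)"
  proof (intro nn_integral_mono)
    fix u :: 'a
    have "(\<integral>\<^sup>+\<rho>. ennreal (2 ^ DIM('a)) * (K u \<rho> * indicator {1-\<delta>..b} \<rho>) \<partial>lborel)
      = ennreal (2 ^ DIM('a)) * (ennreal (F u) * (\<integral>\<^sup>+\<rho>\<in>{1-\<delta>..b}. k (norm u) \<rho> \<partial>lborel))"
      by (simp add: nn_integral_cmult K_def mult.assoc)
    also have "\<dots> \<le> ennreal (2 ^ DIM('a)) * (ennreal (F u) * ennreal (C * \<delta> * (1 - norm u) powr \<alpha>))"
    proof (cases "norm u \<le> b")
      case True
      then show ?thesis
        using C[of "norm u"] by (intro mult_left_mono) (auto simp: k_def b_def)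
    qed (auto simp: F_def)
    also have "\<dots> = ennreal (2 ^ DIM('a) * C * \<delta>) *
      (ennreal (norm (f u) * (1 - norm u) powr \<alpha>) * indicator (cball 0 b) u)"
      using \<delta> \<open>C \<ge> 0\<close> by (auto simp: F_def indicator_def ennreal_mult[symmetric] mult_ac)
    finally show "(\<integral>\<^sup>+\<rho>. ennreal (2 ^ DIM('a)) * (K u \<rho> * indicator {1-\<delta>..b} \<rho>) \<partial>lborel) \<le> \<dots>" .
  qed
  also have "\<dots> = ennreal (2 ^ DIM('a) * C * \<delta>) * wint \<alpha> f (cball 0 b)"
  proof -
    have "(\<lambda>u. indicator (cball 0 b) u *\<^sub>R (norm (f u) * (1 - norm u) powr \<alpha>)) \<in> borel_measurable borel"
      using \<delta> by (intro borel_measurable_continuous_on_indicator)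
        (auto intro!: continuous_intros continuous_on_subset[OF f] simp: b_def)
    then have "(\<lambda>u. ennreal (indicator (cball 0 b) u *\<^sub>R (norm (f u) * (1 - norm u) powr \<alpha>))) \<in> borel_measurable borel"
      by measurable
    also have "(\<lambda>u. ennreal (indicator (cball 0 b) u *\<^sub>R (norm (f u) * (1 - norm u) powr \<alpha>)))
       = (\<lambda>u. ennreal (norm (f u) * (1 - norm u) powr \<alpha>) * indicator (cball 0 b) u)"
      by (auto simp: indicator_def)
    finally show ?thesis
      unfolding wint_def by (intro nn_integral_cmult) simp
  qed
  finally show ?thesis
    by (simp add: b_def)
qed

section \<open>Basic properties of the integrals \<open>A_int\<close>\<close>

lemma emeasure_unit_ball:
  "emeasure lborel (ball (0::'a::euclidean_space) 1) = ennreal (measure lborel (ball (0::'a) 1))"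
  using emeasure_lborel_ball_finite[of "0::'a" 1] by (intro emeasure_eq_ennreal_measure) auto

lemma set_integrable_weighted_norm:
  fixes f :: "'a::euclidean_space \<Rightarrow> 'b::real_normed_vector"
  assumes f: "continuous_on (ball 0 1) f" and r: "r < 1"
  shows "set_integrable (uniform_measure lborel (ball 0 1)) (cball 0 r) (\<lambda>w. norm (f w) * (1 - norm w) powr \<alpha>)"
proof -
  let ?U = "uniform_measure lborel (ball (0::'a) 1)"
  define q where "q w = norm (f w) * (1 - norm w) powr \<alpha>" for w
  have q: "continuous_on (cball 0 r) q"
    using r unfolding q_def by (auto intro!: continuous_intros continuous_on_subset[OF f])
  interpret finite_measure ?U
    using content_ball_pos[of 1 "0::'a"]
    by (intro finite_measureI) (simp add: emeasure_unit_ball divide_ennreal)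
  have "bounded (q ` cball 0 r)"
    using compact_continuous_image[OF q] by (simp add: compact_imp_bounded)
  then obtain B where B: "\<And>w. w \<in> cball 0 r \<Longrightarrow> norm (q w) \<le> B"
    unfolding bounded_iff by blast
  show ?thesis
    unfolding set_integrable_def q_def[symmetric]
  proof (rule integrable_const_bound)
    show "AE w in ?U. norm (indicator (cball 0 r) w *\<^sub>R q w) \<le> max 0 B"
      using B by (intro AE_I2) (auto simp: indicator_def le_max_iff_disj)
    have "(\<lambda>w. indicator (cball 0 r) w *\<^sub>R q w) \<in> borel_measurable borel"
      by (intro borel_measurable_continuous_on_indicator q) auto
    then show "(\<lambda>w. indicator (cball 0 r) w *\<^sub>R q w) \<in> borel_measurable ?U"
      by simp
  qed
qed

lemma A_int_nonneg: "A_int \<alpha> f r \<ge> 0"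
  unfolding A_int_def set_lebesgue_integral_def by (intro integral_nonneg_AE) auto

text \<open>For \<open>r < 1\<close> the integrand is integrable, so the Bochner integral equals the
  nonnegative one; the normalization of the measure leaves the volume of the unit ball as a factor.
  This carries estimates between the two notions.\<close>

lemma wint_cball:
  fixes f :: "'a::euclidean_space \<Rightarrow> 'b::real_normed_vector"
  assumes f: "continuous_on (ball 0 1) f" and r: "r < 1"
  shows "wint \<alpha> f (cball 0 r) = ennreal (measure lborel (ball (0::'a) 1) * A_int \<alpha> f r)"
proof -
  let ?U = "uniform_measure lborel (ball (0::'a) 1)"
  let ?V = "measure lborel (ball (0::'a) 1)"
  define h where "h w = indicator (cball 0 r) w *\<^sub>R (norm (f w) * (1 - norm w) powr \<alpha>)" for w
  have V: "?V > 0"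
    using content_ball_pos[of 1 "0::'a"] by simp
  have int: "integrable ?U h"
    using set_integrable_weighted_norm[OF f r] unfolding set_integrable_def h_def .
  then have [measurable]: "h \<in> borel_measurable borel"
    using borel_measurable_integrable by fastforce
  have "ennreal (A_int \<alpha> f r) = ennreal (\<integral>w. h w \<partial>?U)"
    by (simp add: A_int_def set_lebesgue_integral_def h_def)
  also have "\<dots> = (\<integral>\<^sup>+w. ennreal (h w) \<partial>?U)"
    by (intro nn_integral_eq_integral[symmetric] int) (auto simp: h_def)
  also have "\<dots> = (\<integral>\<^sup>+w. ennreal (h w) * indicator (ball 0 1) w \<partial>lborel) / ennreal ?V"
    by (subst nn_integral_uniform_measure) (auto simp: emeasure_unit_ball)
  also have "(\<integral>\<^sup>+w. ennreal (h w) * indicator (ball 0 1) w \<partial>lborel) = wint \<alpha> f (cball 0 r)"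
    unfolding wint_def using r by (intro nn_integral_cong) (auto simp: h_def indicator_def)
  finally have "ennreal ?V * ennreal (A_int \<alpha> f r) = ennreal ?V * (wint \<alpha> f (cball 0 r) / ennreal ?V)"
    by simp
  also have "\<dots> = wint \<alpha> f (cball 0 r)"
    using V by (simp add: ennreal_times_divide ennreal_mult_divide_eq mult.commute[of "ennreal _"])
  finally show ?thesis
    using V by (simp add: ennreal_mult' A_int_nonneg)
qed

lemma A_int_mono:
  assumes f: "continuous_on (ball 0 1) f" and "r \<le> r'" "r' < 1"
  shows "A_int \<alpha> f r \<le> A_int \<alpha> f r'"
proof -
  have "wint \<alpha> f (cball 0 r) \<le> wint \<alpha> f (cball 0 r')"
    using assms by (intro wint_mono) auto
  then show ?thesis
    using assms content_ball_pos[of 1 "0::'a"]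
    by (simp add: wint_cball[OF f] ennreal_le_iff A_int_nonneg)
qed

text \<open>Stated with a pointwise bound so that it serves twice: for \<open>f - g\<close> against
  \<open>f\<close> and \<open>g\<close>, and for \<open>f\<close> against \<open>f - g\<close> and
  \<open>g\<close>.\<close>

lemma A_int_triangle:
  assumes "continuous_on (ball 0 1) f" "continuous_on (ball 0 1) g" "continuous_on (ball 0 1) h"
    and le: "\<And>w. w \<in> ball 0 1 \<Longrightarrow> norm (f w) \<le> norm (g w) + norm (h w)" and "r < 1"
  shows "A_int \<alpha> f r \<le> A_int \<alpha> g r + A_int \<alpha> h r"
proof -
  let ?I = "\<lambda>q. set_lebesgue_integral (uniform_measure lborel (ball 0 1)) (cball 0 r) q"
  let ?w = "\<lambda>w. (1 - norm w) powr \<alpha>"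
  note int = set_integrable_weighted_norm[OF _ \<open>r < 1\<close>]
  have "?I (\<lambda>w. norm (f w) * ?w w) \<le> ?I (\<lambda>w. norm (g w) * ?w w + norm (h w) * ?w w)"
    using assms
    by (intro set_integral_mono set_integral_add int)
      (auto simp: distrib_right[symmetric] intro!: mult_right_mono)
  also have "\<dots> = ?I (\<lambda>w. norm (g w) * ?w w) + ?I (\<lambda>w. norm (h w) * ?w w)"
    using assms by (intro set_integral_add int)
  finally show ?thesis
    by (simp add: A_int_def)
qed

lemma A_int_le_const:
  fixes f :: "'a::euclidean_space \<Rightarrow> 'b::real_normed_vector"
  assumes f: "continuous_on (ball 0 1) f" and "r < 1"
    and le: "\<And>w. w \<in> cball 0 r \<Longrightarrow> norm (f w) \<le> c"
  shows "A_int \<alpha> f r \<le> c * A_int \<alpha> (\<lambda>_::'a. 1::real) r"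
proof -
  let ?I = "\<lambda>q. set_lebesgue_integral (uniform_measure lborel (ball 0 1)) (cball 0 r) q"
  let ?w = "\<lambda>w. (1 - norm w) powr \<alpha>"
  note int = set_integrable_weighted_norm[OF _ \<open>r < 1\<close>]
  have 1: "set_integrable (uniform_measure lborel (ball 0 1)) (cball 0 r) (\<lambda>w::'a. c * (norm (1::real) * ?w w))"
    by (intro set_integrable_mult_right set_integrable_weighted_norm \<open>r < 1\<close>) simp
  have "?I (\<lambda>w. norm (f w) * ?w w) \<le> ?I (\<lambda>w::'a. c * (norm (1::real) * ?w w))"
    by (rule set_integral_mono[OF int[OF f] 1]) (auto intro!: mult_right_mono le)
  then show ?thesis
    by (simp add: A_int_def)
qed

section \<open>Approximation by a dilate\<close>

text \<open>With \<open>g\<close> the dilate, three ranges of \<open>r\<close> are treated: below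
  \<open>R\<close> by uniform continuity, from \<open>R\<close> to \<open>1 - \<delta>\<close> by
  comparing weights, and beyond \<open>1 - \<delta>\<close> by the averaged bound on
  \<open>g\<close> over the whole ball. \<open>K\<close> is fixed before \<open>f\<close>,
  \<epsilon> and \<open>R\<close>; the bound \<open>B\<close> later puts the dilate into
  \<open>Mp_space\<close>.\<close>

lemma exists_dilate_approx:
  fixes \<alpha> \<beta> :: real
  assumes \<alpha>: "\<alpha> > -1" and \<beta>: "\<beta> > 0"
  shows "\<exists>K>0. \<forall>(f :: 'a::euclidean_space \<Rightarrow> 'b::real_normed_vector) \<epsilon> R.
      continuous_on (ball 0 1) f \<longrightarrow> \<epsilon> > 0 \<longrightarrow> 0 \<le> R \<longrightarrow> R < 1 \<longrightarrow>
      (\<forall>r. R \<le> r \<longrightarrow> r < 1 \<longrightarrow> (1 - r) powr \<beta> * A_int \<alpha> f r \<le> \<epsilon>) \<longrightarrow>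
      (\<exists>\<rho> B. 0 < \<rho> \<and> \<rho> < 1 \<and> (\<forall>r<1. A_int \<alpha> (\<lambda>w. f (\<rho> *\<^sub>R w)) r \<le> B) \<and>
        (\<forall>r\<in>{0..<1}. (1 - r) powr \<beta> * A_int \<alpha> (\<lambda>w. f w - f (\<rho> *\<^sub>R w)) r \<le> K * \<epsilon>))"
proof -
  obtain C where C0: "C > 0" and C: "\<forall>\<delta> s. 0 < \<delta> \<longrightarrow> \<delta> \<le> 1/2 \<longrightarrow> 0 \<le> s \<longrightarrow> s \<le> 1 - \<delta>/2 \<longrightarrow>
      (\<integral>\<^sup>+\<rho>\<in>{1-\<delta>..1-\<delta>/2}. (if s < \<rho> then ennreal ((1 - s / \<rho>) powr \<alpha>) else 0) \<partial>lborel)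
        \<le> ennreal (C * \<delta> * (1 - s) powr \<alpha>)"
    using nn_integral_dilated_weight_le[OF \<alpha>] by blast
  \<comment> \<open>\<open>K1\<close> is the factor of the weight comparison. \<open>N\<close>
    doubles the averaging constant because the interval of dilation factors has length
    \<open>\<delta>/2\<close>. In \<open>K2\<close>, \<open>2 powr \<beta>\<close> comes from
    \<open>\<delta> = 2 * (1 - b)\<close> and the 1 from the slack in choosing \<rho>. The 1 in
    \<open>K\<close> accounts for \<open>f\<close> itself.\<close>
  define K1 :: real where "K1 = 2 ^ DIM('a) * 2 powr \<bar>\<alpha>\<bar>"
  define N :: real where "N = 2 * (2 ^ DIM('a) * C)"
  define K2 :: real where "K2 = 2 powr \<beta> * N + 1"
  define K where "K = 1 + K1 + K2"
  have N0: "N > 0"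
    using C0 by (simp add: N_def)
  have K0: "K1 > 0" "K2 > 0"
    using N0 by (auto simp: K1_def K2_def intro!: add_pos_pos)
  show ?thesis
  proof (rule exI[of _ K], intro conjI allI impI)
    show "K > 0"
      using K0 by (simp add: K_def)
    fix f :: "'a \<Rightarrow> 'b" and \<epsilon> R :: real
    assume f: "continuous_on (ball 0 1) f" and \<epsilon>: "\<epsilon> > 0" and R: "0 \<le> R" "R < 1"
      and "\<forall>r. R \<le> r \<longrightarrow> r < 1 \<longrightarrow> (1 - r) powr \<beta> * A_int \<alpha> f r \<le> \<epsilon>"
    note small = this(5)[rule_format]
    define V where "V = measure lborel (ball (0::'a) 1)"
    have V: "V > 0"
      using content_ball_pos[of 1 "0::'a"] by (simp add: V_def)
    \<comment> \<open>The weighted mass of \<open>cball 0 R\<close>. It may vanish, which is why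
      \<epsilon> is divided by \<open>T + 1\<close> below.\<close>
    define T where "T = A_int \<alpha> (\<lambda>_::'a. 1::real) R"
    have T: "T \<ge> 0"
      by (simp add: T_def A_int_nonneg)
    have "uniformly_continuous_on (cball 0 R) f"
      using R by (intro compact_uniformly_continuous continuous_on_subset[OF f]) auto
    moreover have "\<epsilon> / (T + 1) > 0"
      using \<epsilon> T by simp
    ultimately obtain d where d: "d > 0" "\<forall>x\<in>cball 0 R. \<forall>y\<in>cball 0 R. dist y x < d
        \<longrightarrow> dist (f y) (f x) < \<epsilon> / (T + 1)"
      unfolding uniformly_continuous_on_def by blast
    \<comment> \<open>The bounds ensure in turn \<open>\<rho> \<ge> 1/2\<close>,
      \<open>R \<le> b\<close> so that the smallness hypothesis holds at \<open>b\<close>, and a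
      displacement \<open>norm (w - \<rho> *\<^sub>R w)\<close> below \<open>d\<close>.\<close>
    define \<delta> where "\<delta> = min (1/2) (min (1 - R) (d/2))"
    have \<delta>: "0 < \<delta>" "\<delta> \<le> 1/2" "\<delta> \<le> 1 - R" "\<delta> < d"
      using d(1) R by (auto simp: \<delta>_def min_def)
    define b where "b = 1 - \<delta>/2"
    have b: "R \<le> b" "b < 1" "1 - b = \<delta>/2"
      using \<delta> R by (auto simp: b_def)
    have "(\<integral>\<^sup>+\<rho>\<in>{1-\<delta>..b}. wint \<alpha> (\<lambda>w. f (\<rho> *\<^sub>R w)) (ball 0 1) \<partial>lborel)
      \<le> ennreal (2 ^ DIM('a) * C * \<delta>) * wint \<alpha> f (cball 0 b)"
      unfolding b_def using \<delta> C0 by (intro wint_dilate_average_le f C[rule_format]) auto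
    also have "\<dots> = ennreal ((b - (1 - \<delta>)) * (N * V * A_int \<alpha> f b))"
      using b \<delta> C0 V unfolding wint_cball[OF f \<open>b < 1\<close>] V_def[symmetric]
      by (subst ennreal_mult[symmetric]) (auto simp: A_int_nonneg N_def b_def)
    \<comment> \<open>Some \<rho> does no worse than the average; the slack
      \<open>V * \<epsilon>\<close> becomes \<epsilon> after division by the volume
      \<open>V\<close>.\<close>
    finally obtain \<rho> where \<rho>: "\<rho> \<in> {1-\<delta>..b}"
      "wint \<alpha> (\<lambda>w. f (\<rho> *\<^sub>R w)) (ball 0 1) \<le> ennreal (N * V * A_int \<alpha> f b + V * \<epsilon>)"
      using \<delta> V \<epsilon> N0 b by (elim nn_integral_Icc_exists_le[rotated -1]) (auto simp: A_int_nonneg b_def)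
    have \<rho>': "1/2 \<le> \<rho>" "\<rho> < 1" "1 - \<delta> \<le> \<rho>" "0 < \<rho>"
      using \<rho> b \<delta> by auto
    define g where "g = (\<lambda>w. f (\<rho> *\<^sub>R w))"
    have scale: "\<rho> * norm w \<le> norm w" for w :: 'a
      using \<rho>' by (intro mult_left_le_one_le) auto
    have g: "continuous_on (ball 0 1) g"
      unfolding g_def using \<rho>' scale
      by (intro continuous_on_compose2[OF f] continuous_intros) (auto intro: le_less_trans[OF scale])
    have fg: "continuous_on (ball 0 1) (\<lambda>w. f w - g w)"
      by (intro continuous_intros f g)
    have gB: "A_int \<alpha> g r \<le> N * A_int \<alpha> f b + \<epsilon>" if "r < 1" for r
    proof -
      have "ennreal (V * A_int \<alpha> g r) = wint \<alpha> g (cball 0 r)"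
        using wint_cball[OF g that] by (simp add: V_def)
      also have "\<dots> \<le> wint \<alpha> g (ball 0 1)"
        using that by (intro wint_mono) auto
      also have "\<dots> \<le> ennreal (V * (N * A_int \<alpha> f b + \<epsilon>))"
        using \<rho>(2) by (simp add: g_def algebra_simps)
      finally have "V * A_int \<alpha> g r \<le> V * (N * A_int \<alpha> f b + \<epsilon>)"
        using V N0 \<epsilon> by (subst (asm) ennreal_le_iff) (auto simp: A_int_nonneg intro!: mult_nonneg_nonneg add_nonneg_nonneg)
      then show ?thesis
        using V by simp
    qed
    have "(1 - r) powr \<beta> * A_int \<alpha> (\<lambda>w. f w - g w) r \<le> K * \<epsilon>" if r: "0 \<le> r" "r < 1" for r
    proof (cases "r < R")
      case True
      have "A_int \<alpha> (\<lambda>w. f w - g w) r \<le> A_int \<alpha> (\<lambda>w. f w - g w) R"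
        using True R by (intro A_int_mono fg) auto
      also have "\<dots> \<le> \<epsilon> / (T + 1) * T"
        unfolding T_def
      proof (intro A_int_le_const fg)
        fix w :: 'a assume w: "w \<in> cball 0 R"
        have "dist (\<rho> *\<^sub>R w) w = norm ((1 - \<rho>) *\<^sub>R w)"
          by (simp add: dist_norm norm_minus_commute algebra_simps)
        also have "\<dots> = (1 - \<rho>) * norm w"
          using \<rho>' by simp
        also have "\<dots> \<le> \<delta> * 1"
          using w R \<rho>' \<delta> by (intro mult_mono) auto
        finally have "dist (f (\<rho> *\<^sub>R w)) (f w) < \<epsilon> / (T + 1)"
          using w scale[of w] \<delta> \<rho>' by (intro d(2)[rule_format]) auto
        then show "norm (f w - g w) \<le> \<epsilon> / (A_int \<alpha> (\<lambda>_::'a. 1::real) R + 1)"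
          by (simp add: g_def dist_norm norm_minus_commute T_def)
      qed (use R in auto)
      also have "\<dots> \<le> \<epsilon>"
        using T \<epsilon> by (simp add: field_simps)
      finally have "(1 - r) powr \<beta> * A_int \<alpha> (\<lambda>w. f w - g w) r \<le> 1 * \<epsilon>"
        using r \<beta> \<epsilon> by (intro mult_mono) (auto simp: A_int_nonneg intro!: powr_le1)
      also have "\<dots> \<le> K * \<epsilon>"
        using \<epsilon> K0 by (intro mult_right_mono) (auto simp: K_def)
      finally show ?thesis .
    next
      case False
      have "(1 - r) powr \<beta> * A_int \<alpha> g r \<le> (K1 + K2) * \<epsilon>"
      proof (cases "r \<le> 1 - \<delta>")
        case True
        have "ennreal (V * A_int \<alpha> g r) \<le> ennreal K1 * ennreal (V * A_int \<alpha> f r)"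
          using wint_dilate_le[OF f \<rho>'(1-3) r(1) True r(2), of \<alpha>]
          by (simp add: wint_cball[OF f r(2)] g_def[symmetric] wint_cball[OF g r(2)] V_def K1_def)
        then have "V * A_int \<alpha> g r \<le> V * (K1 * A_int \<alpha> f r)"
          using V K0 by (simp add: ennreal_mult'[symmetric] ennreal_le_iff A_int_nonneg mult_ac)
        then have "(1 - r) powr \<beta> * A_int \<alpha> g r \<le> (1 - r) powr \<beta> * (K1 * A_int \<alpha> f r)"
          using V by (intro mult_left_mono) auto
        also have "\<dots> = K1 * ((1 - r) powr \<beta> * A_int \<alpha> f r)"
          by simp
        also have "\<dots> \<le> K1 * \<epsilon>"
          using K0 small[of r] False r by (intro mult_left_mono) auto
        also have "\<dots> \<le> (K1 + K2) * \<epsilon>"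
          using \<epsilon> K0 by (intro mult_right_mono) auto
        finally show ?thesis .
      next
        case False
        \<comment> \<open>The bound \<open>gB\<close> is the same for all \<open>r\<close>, and
          \<open>1 - r < \<delta> = 2 * (1 - b)\<close>; hence the hypothesis at the single radius
          \<open>b\<close> controls this whole range.\<close>
        have "(1 - r) powr \<beta> * A_int \<alpha> g r \<le> \<delta> powr \<beta> * (N * A_int \<alpha> f b + \<epsilon>)"
          using False r \<beta> gB[of r] by (intro mult_mono powr_mono2) (auto simp: A_int_nonneg)
        also have "\<dots> = 2 powr \<beta> * N * ((1 - b) powr \<beta> * A_int \<alpha> f b) + \<delta> powr \<beta> * \<epsilon>"
          unfolding b(3) using \<delta> by (simp add: powr_divide algebra_simps)
        also have "\<dots> \<le> 2 powr \<beta> * N * \<epsilon> + 1 * \<epsilon>"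
          using small[OF b(1,2)] \<delta> \<beta> \<epsilon> N0
          by (intro add_mono mult_mono powr_le1) (auto simp: A_int_nonneg)
        also have "\<dots> \<le> (K1 + K2) * \<epsilon>"
          using \<epsilon> K0 by (simp add: K2_def algebra_simps)
        finally show ?thesis .
      qed
      moreover have "(1 - r) powr \<beta> * A_int \<alpha> (\<lambda>w. f w - g w) r
          \<le> (1 - r) powr \<beta> * (A_int \<alpha> f r + A_int \<alpha> g r)"
        using r by (intro mult_left_mono A_int_triangle f g fg norm_triangle_ineq4) auto
      moreover have "(1 - r) powr \<beta> * A_int \<alpha> f r \<le> \<epsilon>"
        using False r by (intro small) auto
      ultimately show ?thesis
        by (simp add: K_def algebra_simps)
    qed
    then show "\<exists>\<rho> B. 0 < \<rho> \<and> \<rho> < 1 \<and> (\<forall>r<1. A_int \<alpha> (\<lambda>w. f (\<rho> *\<^sub>R w)) r \<le> B) \<and>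
        (\<forall>r\<in>{0..<1}. (1 - r) powr \<beta> * A_int \<alpha> (\<lambda>w. f w - f (\<rho> *\<^sub>R w)) r \<le> K * \<epsilon>)"
      using \<rho>' gB unfolding g_def by (intro exI[of _ \<rho>] exI[of _ "N * A_int \<alpha> f b + \<epsilon>"]) auto
  qed
qed

section \<open>Membership in \<open>Mp_space\<close> and growth bounds from level sets\<close>

text \<open>Measurability comes from monotonicity in \<open>r\<close>, which is available on the
  unit interval; hence the cutoff.\<close>

lemma borel_measurable_A_int:
  assumes f: "continuous_on (ball 0 1) f"
  shows "(\<lambda>r. indicator {0<..<1} r * A_int \<alpha> f r) \<in> borel_measurable borel"
proof -
  have "mono_on {0<..<1} (A_int \<alpha> f)"
    by (intro mono_onI A_int_mono f) auto
  from borel_measurable_mono_on_fnc[OF this] show ?thesis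
    by (simp add: borel_measurable_restrict_space_iff)
qed

text \<open>The remaining integral of \<open>(1 - r) powr (\<beta> * p - 1)\<close> converges at 1
  because \<open>\<beta> * p > 0\<close>.\<close>

lemma Mp_spaceI:
  assumes p: "1 \<le> p" and \<beta>: "\<beta> > 0" and g: "harmonic_on (ball 0 1) g"
    and B: "\<And>r. r < 1 \<Longrightarrow> A_int \<alpha> g r \<le> B"
  shows "g \<in> Mp_space \<alpha> p \<beta>"
proof -
  have "(\<integral>\<^sup>+r\<in>{0<..<1}. ennreal ((1 - r) powr (\<beta> * p - 1) * A_int \<alpha> g r powr p) \<partial>lborel)
      \<le> (\<integral>\<^sup>+r. ennreal (B powr p) * (ennreal ((1 - r) powr (\<beta> * p - 1)) * indicator {0<..<1} r) \<partial>lborel)"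
  proof (intro nn_integral_mono)
    fix r :: real
    have "(1 - r) powr (\<beta> * p - 1) * A_int \<alpha> g r powr p \<le> B powr p * (1 - r) powr (\<beta> * p - 1)"
      if "r < 1"
      using that B[OF that] p
      by (subst mult.commute) (intro mult_right_mono powr_mono2, auto simp: A_int_nonneg)
    then show "ennreal ((1 - r) powr (\<beta> * p - 1) * A_int \<alpha> g r powr p) * indicator {0<..<1} r
        \<le> ennreal (B powr p) * (ennreal ((1 - r) powr (\<beta> * p - 1)) * indicator {0<..<1} r)"
      by (auto simp: indicator_def ennreal_mult'[symmetric] intro!: ennreal_leI)
  qed
  also have "\<dots> = ennreal (B powr p) *
      (\<integral>\<^sup>+r\<in>{0<..<1}. ennreal ((1 - r) powr (\<beta> * p - 1)) \<partial>lborel)"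
    by (intro nn_integral_cmult) measurable
  also have "\<dots> < \<infinity>"
    using nn_integral_one_minus_powr_finite[of "\<beta> * p"] p \<beta> by (simp add: ennreal_mult_less_top)
  finally show ?thesis
    using g by (simp add: Mp_space_def)
qed

text \<open>A radius \<open>r\<close> violating the bound puts \<open>{r<..<(1+r)/2}\<close> inside
  the level set, and this interval has mass at least 1/2 for the density
  \<open>inverse (1 - x)\<close>. Finite total mass makes the tails near 1 lighter than
  that.\<close>

lemma L_set_finite_imp_eventually_le:
  assumes f: "continuous_on (ball 0 1) f" and \<beta>: "\<beta> > 0" and \<epsilon>: "\<epsilon> > 0"
    and fin: "(\<integral>\<^sup>+r\<in>{0<..<1}. indicator (L_set \<alpha> \<epsilon> \<beta> f) r * ennreal (inverse (1 - r)) \<partial>lborel) < \<infinity>"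
  shows "\<exists>R\<in>{0..<1}. \<forall>r\<in>{R..<1}. (1 - r) powr \<beta> * A_int \<alpha> f r \<le> 2 powr \<beta> * \<epsilon>"
proof -
  define X where "X = {r\<in>{0..<1}. (1 - r) powr \<beta> * A_int \<alpha> f r > 2 powr \<beta> * \<epsilon>}"
  \<comment> \<open>An open, hence measurable, subset of the level set on which the finite measure
    \<nu> below is built.\<close>
  define U where "U = (\<Union>r\<in>X. {r<..<(1+r)/2})"
  have "open U"
    by (auto simp: U_def)
  then have [measurable]: "U \<in> sets borel"
    by simp
  have UL: "U \<subseteq> L_set \<alpha> \<epsilon> \<beta> f"
  proof
    fix x assume "x \<in> U"
    then obtain r where r: "0 \<le> r" "r < 1" "2 powr \<beta> * \<epsilon> < (1 - r) powr \<beta> * A_int \<alpha> f r"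
      and x: "r < x" "x < (1+r)/2"
      by (auto simp: U_def X_def)
    have "2 powr \<beta> * \<epsilon> \<le> (1 - r) powr \<beta> * A_int \<alpha> f r"
      using r by simp
    \<comment> \<open>\<open>x < (1+r)/2\<close> means \<open>1 - r < 2 * (1 - x)\<close>, which is
      the source of the factor \<open>2 powr \<beta>\<close>; \<open>A_int\<close> only grows from
      \<open>r\<close> to \<open>x\<close>.\<close>
    also have "\<dots> \<le> (2 * (1 - x)) powr \<beta> * A_int \<alpha> f x"
      using x r \<beta> by (intro mult_mono powr_mono2 A_int_mono f) (auto simp: A_int_nonneg field_simps)
    also have "\<dots> = 2 powr \<beta> * ((1 - x) powr \<beta> * A_int \<alpha> f x)"
      using x r powr_mult[of 2 "1 - x" \<beta>] by simp
    finally show "x \<in> L_set \<alpha> \<epsilon> \<beta> f"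
      using x r by (simp add: L_set_def)
  qed
  define \<nu> where "\<nu> = density lborel (\<lambda>x. indicator U x * ennreal (inverse (1 - x)))"
  have "emeasure \<nu> UNIV
      \<le> (\<integral>\<^sup>+r\<in>{0<..<1}. indicator (L_set \<alpha> \<epsilon> \<beta> f) r * ennreal (inverse (1 - r)) \<partial>lborel)"
    unfolding \<nu>_def using UL
    by (subst emeasure_density) (auto intro!: nn_integral_mono simp: indicator_def L_set_def)
  also note fin
  finally have \<nu>: "emeasure \<nu> A \<noteq> \<infinity>" for A
    using emeasure_mono[of A UNIV \<nu>] by (auto simp: \<nu>_def)
  define S where "S n = {1 - 1 / real (Suc n)..<1}" for n
  have "(\<lambda>n. emeasure \<nu> (S n)) \<longlonglongrightarrow> emeasure \<nu> (\<Inter>n. S n)"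
  proof (rule Lim_emeasure_decseq)
    show "decseq S"
      by (intro decseq_SucI) (auto simp: S_def field_simps)
  qed (use \<nu> in \<open>auto simp: S_def \<nu>_def\<close>)
  also have "(\<Inter>n. S n) = {}"
  proof -
    have "x \<notin> (\<Inter>n. S n)" for x
    proof (cases "x < 1")
      case True
      then obtain n where "1 / real (Suc n) < 1 - x"
        using nat_approx_posE[of "1 - x"] by auto
      then have "x \<notin> S n"
        by (auto simp: S_def)
      then show ?thesis
        by blast
    qed (auto simp: S_def)
    then show ?thesis
      by blast
  qed
  finally have "(\<lambda>n. emeasure \<nu> (S n)) \<longlonglongrightarrow> 0"
    by simp
  then have "\<forall>\<^sub>F n in sequentially. emeasure \<nu> (S n) < ennreal (1/2)"
    by (rule order_tendstoD) (subst ennreal_less_zero_iff, simp)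
  then obtain n where n: "emeasure \<nu> (S n) < ennreal (1/2)"
    by (auto simp: eventually_sequentially)
  show ?thesis
  proof (intro bexI[of _ "1 - 1 / real (Suc n)"] ballI)
    fix r assume "r \<in> {1 - 1 / real (Suc n)..<1}"
    then have r: "1 - 1 / real (Suc n) \<le> r" "r < 1"
      by auto
    have "0 \<le> 1 - 1 / real (Suc n)"
      by simp
    then have r0: "0 \<le> r"
      using r(1) by linarith
    show "(1 - r) powr \<beta> * A_int \<alpha> f r \<le> 2 powr \<beta> * \<epsilon>"
    proof (rule ccontr)
      assume "\<not> ?thesis"
      then have "{r<..<(1+r)/2} \<subseteq> U"
        using r r0 by (force simp: U_def X_def)
      \<comment> \<open>The interval has length \<open>(1 - r) / 2\<close> and the density on it is
        at least \<open>inverse (1 - r)\<close>.\<close>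
      have "ennreal (1/2) = (\<integral>\<^sup>+x. ennreal (inverse (1 - r)) * indicator {r<..<(1+r)/2} x \<partial>lborel)"
        using r by (subst nn_integral_cmult_indicator) (auto simp: ennreal_mult[symmetric] field_simps)
      also have "\<dots> \<le> (\<integral>\<^sup>+x. indicator U x * ennreal (inverse (1 - x)) * indicator (S n) x \<partial>lborel)"
      proof (intro nn_integral_mono)
        fix x
        show "ennreal (inverse (1 - r)) * indicator {r<..<(1+r)/2} x
            \<le> indicator U x * ennreal (inverse (1 - x)) * indicator (S n) x"
        proof (cases "x \<in> {r<..<(1+r)/2}")
          case True
          then have "x \<in> U" "x \<in> S n"
            using \<open>_ \<subseteq> U\<close> r by (auto simp: S_def)
          then show ?thesis
            using True r by (auto intro!: ennreal_leI le_imp_inverse_le)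
        qed auto
      qed
      also have "\<dots> = emeasure \<nu> (S n)"
        unfolding \<nu>_def by (subst emeasure_density) (auto simp: S_def)
      finally show False
        using n by simp
    qed
  qed auto
qed

section \<open>The two inequalities between \<open>t1\<close> and \<open>t2\<close>\<close>

text \<open>A Chebyshev argument. If \<open>f - g\<close> has norm \<eta>, then on the level set of
  \<open>f\<close> at height \<open>\<eta> + e\<close> the quantity
  \<open>(1 - r) powr \<beta> * A_int \<alpha> g r\<close> is at least \<open>e\<close>. Its
  \<open>p\<close>-th power divided by \<open>e powr p\<close> then dominates 1, and the finite
  integral for \<open>g\<close> makes \<open>\<eta> + e\<close> admissible in
  \<open>t2\<close>.\<close>

lemma t2_le_t1:
  fixes f :: "'a::euclidean_space \<Rightarrow> 'b::real_normed_vector"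
  assumes p: "1 \<le> p" and f: "continuous_on (ball 0 1) f"
  shows "t2 \<alpha> \<beta> f \<le> t1 \<alpha> \<beta> p f"
  unfolding t1_def
proof (rule INF_greatest)
  fix g :: "'a \<Rightarrow> 'b" assume "g \<in> Mp_space \<alpha> p \<beta>"
  then have g: "continuous_on (ball 0 1) g"
    and gfin: "(\<integral>\<^sup>+r\<in>{0<..<1}. ennreal ((1 - r) powr (\<beta> * p - 1) * A_int \<alpha> g r powr p) \<partial>lborel) < \<infinity>"
    by (auto simp: Mp_space_def harmonic_on_imp_continuous_on)
  note fg = continuous_on_diff[OF f g]
  show "t2 \<alpha> \<beta> f \<le> M_norm \<alpha> \<beta> (\<lambda>w. f w - g w)"
  \<comment> \<open>This leaves only competitors at finite distance and supplies the
    \<open>e > 0\<close> by which the height must exceed \<eta>.\<close>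
  proof (rule ennreal_le_epsilon)
    fix e :: real assume fin: "M_norm \<alpha> \<beta> (\<lambda>w. f w - g w) < top" and e: "0 < e"
    define \<eta> where "\<eta> = enn2real (M_norm \<alpha> \<beta> (\<lambda>w. f w - g w))"
    have \<eta>: "M_norm \<alpha> \<beta> (\<lambda>w. f w - g w) = ennreal \<eta>" "\<eta> \<ge> 0"
      using fin by (auto simp: \<eta>_def)
    have diff: "(1 - r) powr \<beta> * A_int \<alpha> (\<lambda>w. f w - g w) r \<le> \<eta>" if "0 \<le> r" "r < 1" for r
    proof -
      have "ennreal ((1 - r) powr \<beta> * A_int \<alpha> (\<lambda>w. f w - g w) r) \<le> ennreal \<eta>"
        unfolding \<eta>(1)[symmetric] M_norm_def using that by (intro SUP_upper) auto
      then show ?thesis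
        using \<eta> by (simp add: ennreal_le_iff)
    qed
    define h where "h r = ennreal ((1 - r) powr (\<beta> * p - 1) * A_int \<alpha> g r powr p) * indicator {0<..<1} r" for r
    have "h = (\<lambda>r. ennreal ((1 - r) powr (\<beta> * p - 1) * (indicator {0<..<1} r * A_int \<alpha> g r) powr p)
        * indicator {0<..<1} r)"
      by (auto simp: h_def indicator_def)
    also have "\<dots> \<in> borel_measurable borel"
      using borel_measurable_A_int[OF g, of \<alpha>] by measurable
    finally have [measurable]: "h \<in> borel_measurable borel" .
    have "(\<integral>\<^sup>+r\<in>{0<..<1}. indicator (L_set \<alpha> (\<eta> + e) \<beta> f) r * ennreal (inverse (1 - r)) \<partial>lborel)
        \<le> (\<integral>\<^sup>+r. ennreal (1 / e powr p) * h r \<partial>lborel)"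
    proof (intro nn_integral_mono)
      fix r
      show "indicator (L_set \<alpha> (\<eta> + e) \<beta> f) r * ennreal (inverse (1 - r)) * indicator {0<..<1} r
          \<le> ennreal (1 / e powr p) * h r"
      proof (cases "r \<in> L_set \<alpha> (\<eta> + e) \<beta> f")
        case True
        then have r: "0 < r" "r < 1" "\<eta> + e \<le> (1 - r) powr \<beta> * A_int \<alpha> f r"
          by (auto simp: L_set_def)
        have "\<eta> + e \<le> (1 - r) powr \<beta> * (A_int \<alpha> (\<lambda>w. f w - g w) r + A_int \<alpha> g r)"
          using r(1,2) norm_triangle_sub
          by (intro order.trans[OF r(3)] mult_left_mono A_int_triangle f g fg) (auto simp: add.commute)
        then have "e \<le> (1 - r) powr \<beta> * A_int \<alpha> g r"
          using diff[of r] r by (simp add: algebra_simps)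
        then have "e powr p \<le> ((1 - r) powr \<beta> * A_int \<alpha> g r) powr p"
          using e p by (intro powr_mono2) auto
        \<comment> \<open>Splitting off one factor \<open>1 - r\<close> leaves exactly the integrand
          of \<open>Mp_space\<close> and produces \<open>inverse (1 - r)\<close> on the other
          side.\<close>
        also have "\<dots> = (1 - r) * ((1 - r) powr (\<beta> * p - 1) * A_int \<alpha> g r powr p)"
          using r by (simp add: powr_mult powr_powr A_int_nonneg powr_diff)
        finally have "inverse (1 - r) \<le> 1 / e powr p * ((1 - r) powr (\<beta> * p - 1) * A_int \<alpha> g r powr p)"
          using r e by (simp add: field_simps)
        then show ?thesis
          using True r by (simp add: h_def ennreal_mult'[symmetric] ennreal_leI)
      qed auto
    qed
    also have "\<dots> = ennreal (1 / e powr p) * (\<integral>\<^sup>+r. h r \<partial>lborel)"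
      by (intro nn_integral_cmult) measurable
    also have "\<dots> < \<infinity>"
      using gfin by (simp add: h_def ennreal_mult_less_top)
    finally have "t2 \<alpha> \<beta> f \<le> ennreal (\<eta> + e)"
      unfolding t2_def using \<eta> e by (intro INF_lower) auto
    then show "t2 \<alpha> \<beta> f \<le> M_norm \<alpha> \<beta> (\<lambda>w. f w - g w) + ennreal e"
      using \<eta> e by simp
  qed
qed

text \<open>Each height \<epsilon> admissible in \<open>t2\<close> bounds the growth of
  \<open>f\<close> near 1 by \<open>2 powr \<beta> * \<epsilon>\<close>, and the dilate
  approximation then supplies a competitor at distance at most
  \<open>K * 2 powr \<beta> * \<epsilon>\<close>.\<close>

lemma t1_le_t2:
  fixes \<alpha> \<beta> p :: real
  assumes p: "1 \<le> p" and \<alpha>: "\<alpha> > -1" and \<beta>: "\<beta> > 0"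
  shows "\<exists>C>0. \<forall>f :: 'a::euclidean_space \<Rightarrow> 'b::real_normed_vector.
      harmonic_on (ball 0 1) f \<longrightarrow> t1 \<alpha> \<beta> p f \<le> ennreal C * t2 \<alpha> \<beta> f"
proof -
  obtain K where K0: "K > 0" and K: "\<forall>(f :: 'a \<Rightarrow> 'b) \<epsilon> R.
      continuous_on (ball 0 1) f \<longrightarrow> \<epsilon> > 0 \<longrightarrow> 0 \<le> R \<longrightarrow> R < 1 \<longrightarrow>
      (\<forall>r. R \<le> r \<longrightarrow> r < 1 \<longrightarrow> (1 - r) powr \<beta> * A_int \<alpha> f r \<le> \<epsilon>) \<longrightarrow>
      (\<exists>\<rho> B. 0 < \<rho> \<and> \<rho> < 1 \<and> (\<forall>r<1. A_int \<alpha> (\<lambda>w. f (\<rho> *\<^sub>R w)) r \<le> B) \<and>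
        (\<forall>r\<in>{0..<1}. (1 - r) powr \<beta> * A_int \<alpha> (\<lambda>w. f w - f (\<rho> *\<^sub>R w)) r \<le> K * \<epsilon>))"
    using exists_dilate_approx[OF \<alpha> \<beta>, where 'a='a and 'b='b] by blast
  define C where "C = K * 2 powr \<beta>"
  have C0: "C > 0"
    using K0 by (simp add: C_def)
  show ?thesis
  proof (intro exI[of _ C] conjI C0 allI impI)
    fix f :: "'a \<Rightarrow> 'b" assume f: "harmonic_on (ball 0 1) f"
    then have fc: "continuous_on (ball 0 1) f"
      by (rule harmonic_on_imp_continuous_on)
    \<comment> \<open>Moving \<open>C\<close> to the left leaves a bare infimum on the right, to be
      checked height by height.\<close>
    have "t1 \<alpha> \<beta> p f / ennreal C \<le> t2 \<alpha> \<beta> f"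
      unfolding t2_def
    proof (rule INF_greatest)
      fix \<epsilon> :: real assume "\<epsilon> \<in> {\<epsilon>. 0 < \<epsilon> \<and>
        (\<integral>\<^sup>+r\<in>{0<..<1}. indicator (L_set \<alpha> \<epsilon> \<beta> f) r * ennreal (inverse (1 - r)) \<partial>lborel) < \<infinity>}"
      then have \<epsilon>: "\<epsilon> > 0" and fin:
        "(\<integral>\<^sup>+r\<in>{0<..<1}. indicator (L_set \<alpha> \<epsilon> \<beta> f) r * ennreal (inverse (1 - r)) \<partial>lborel) < \<infinity>"
        by auto
      obtain R where R: "0 \<le> R" "R < 1"
        "\<And>r. \<lbrakk>R \<le> r; r < 1\<rbrakk> \<Longrightarrow> (1 - r) powr \<beta> * A_int \<alpha> f r \<le> 2 powr \<beta> * \<epsilon>"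
        using L_set_finite_imp_eventually_le[OF fc \<beta> \<epsilon> fin] by auto
      obtain \<rho> B where \<rho>: "0 < \<rho>" "\<rho> < 1"
        and B: "\<forall>r<1. A_int \<alpha> (\<lambda>w. f (\<rho> *\<^sub>R w)) r \<le> B"
        and le: "\<forall>r\<in>{0..<1}.
          (1 - r) powr \<beta> * A_int \<alpha> (\<lambda>w. f w - f (\<rho> *\<^sub>R w)) r \<le> K * (2 powr \<beta> * \<epsilon>)"
        using K[rule_format, OF fc _ R(1,2), of "2 powr \<beta> * \<epsilon>"] R(3) \<epsilon> by fastforce
      have "harmonic_on (ball 0 1) (\<lambda>w. f (\<rho> *\<^sub>R w))"
      proof (rule harmonic_on_dilate[OF f])
        fix x :: 'a assume "x \<in> ball 0 1"
        then show "\<rho> *\<^sub>R x \<in> ball 0 1"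
          using \<rho> mult_left_le_one_le[of "norm x" \<rho>] by simp
      qed simp
      then have "(\<lambda>w. f (\<rho> *\<^sub>R w)) \<in> Mp_space \<alpha> p \<beta>"
        using B by (intro Mp_spaceI[where B=B] p \<beta>) auto
      then have "t1 \<alpha> \<beta> p f \<le> M_norm \<alpha> \<beta> (\<lambda>w. f w - f (\<rho> *\<^sub>R w))"
        unfolding t1_def by (rule INF_lower)
      also have "\<dots> \<le> ennreal (C * \<epsilon>)"
        unfolding M_norm_def using le by (intro SUP_least ennreal_leI) (simp add: C_def mult.assoc)
      finally have "t1 \<alpha> \<beta> p f / ennreal C \<le> ennreal (C * \<epsilon>) / ennreal C"
        by (rule divide_right_mono_ennreal)
      then show "t1 \<alpha> \<beta> p f / ennreal C \<le> ennreal \<epsilon>"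
        using C0 \<epsilon> by (simp add: divide_ennreal)
    qed
    then have "ennreal C * (t1 \<alpha> \<beta> p f / ennreal C) \<le> ennreal C * t2 \<alpha> \<beta> f"
      by (rule mult_left_mono) simp
    then show "t1 \<alpha> \<beta> p f \<le> ennreal C * t2 \<alpha> \<beta> f"
      using C0 by (simp add: ennreal_times_divide ennreal_mult_divide_eq mult.commute[of "ennreal _"])
  qed
qed

theorem theorem2p5:
  fixes \<alpha> \<beta> p :: real
  assumes "1 \<le> p" and "\<alpha> > -1" and "\<beta> > 0"
  shows "\<exists>C\<ge>1. \<forall>f :: real^'n \<Rightarrow> 'b::{real_normed_field, euclidean_space}.
           f \<in> M_space \<alpha> \<beta> \<longrightarrow>
             ennreal (inverse C) * t2 \<alpha> \<beta> f \<le> t1 \<alpha> \<beta> p f \<and>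
             t1 \<alpha> \<beta> p f \<le> ennreal C * t2 \<alpha> \<beta> f"
proof -
  obtain K where K0: "K > 0" and K: "\<forall>f :: real^'n \<Rightarrow> 'b.
      harmonic_on (ball 0 1) f \<longrightarrow> t1 \<alpha> \<beta> p f \<le> ennreal K * t2 \<alpha> \<beta> f"
    using t1_le_t2[OF assms, where 'a="real^'n" and 'b='b] by blast
  show ?thesis
  \<comment> \<open>The maximum secures a constant of at least 1; the lower estimate holds with
    constant 1, so its inverse is harmless.\<close>
  proof (intro exI[of _ "max 1 K"] conjI allI impI)
    fix f :: "real^'n \<Rightarrow> 'b" assume "f \<in> M_space \<alpha> \<beta>"
    then have f: "harmonic_on (ball 0 1) f"
      by (simp add: M_space_def)
    have "ennreal (inverse (max 1 K)) * t2 \<alpha> \<beta> f \<le> 1 * t2 \<alpha> \<beta> f"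
      by (intro mult_right_mono) (auto simp: ennreal_le_1 inverse_le_1_iff)
    also have "\<dots> \<le> t1 \<alpha> \<beta> p f"
      using t2_le_t1[OF assms(1) harmonic_on_imp_continuous_on[OF f]] by simp
    finally show "ennreal (inverse (max 1 K)) * t2 \<alpha> \<beta> f \<le> t1 \<alpha> \<beta> p f" .
    show "t1 \<alpha> \<beta> p f \<le> ennreal (max 1 K) * t2 \<alpha> \<beta> f"
      by (intro order.trans[OF K[rule_format, OF f]] mult_right_mono ennreal_leI) auto
  qed simp
qed

end
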